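(* In every $4$-total coloring of a cubic graph of order $12$, the color class configuration is $(8,8,7,7)$ or $(8,8,8,6)$. Both configurations are attained by $4$-total colorings of the circular ladder $L_{12}$; in particular, $(8,8,8,6)$ is the unique configuration of a non-equitable $4$-total coloring of a cubic graph of order $12$.
   Context: All graphs are finite, simple and cubic ($3$-regular), not necessarily connected. The order of a graph is its number of vertices. A $4$-total coloring of $G$ assigns one of the four colors $1,2,3,4$ to each vertex and each edge of $G$ so that adjacent vertices receive distinct colors, adjacent edges (edges sharing an endpoint) receive distinct colors, and every vertex and edge that are incident receive distinct colors. The color class $c_i$ is the set of all vertices and edges of color $i$. The color class configuration of the coloring is the multiset $\{|c_1|,|c_2|,|c_3|,|c_4|\}$, written as a non-increasing sequence. The coloring is equitable if $\bigl||c_i|-|c_j|\bigr| \le 1$ for all $i,j \in \{1,2,3,4\}$, and non-equitable otherwise. For even $n\ge 6$, the circular ladder $L_n$ is the prism $C_{n/2} \,\square\, K_2$ (Cartesian product of a cycle on $n/2$ vertices with $K_2$), which has $n$ vertices; thus $L_{12} = C_6 \,\square\, K_2$. *)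

theory Defs
  imports "HOL-Library.Multiset"
begin

record 'a ugraph =
  verts :: "'a set"
  edges :: "'a set set"

definition simple_graph :: "'a ugraph \<Rightarrow> bool" where
  "simple_graph G \<longleftrightarrow> finite (verts G) \<and> (\<forall>e \<in> edges G. e \<subseteq> verts G \<and> card e = 2)"

definition order :: "'a ugraph \<Rightarrow> nat" where
  "order G = card (verts G)"

definition degree :: "'a ugraph \<Rightarrow> 'a \<Rightarrow> nat" where
  "degree G v = card {e \<in> edges G. v \<in> e}"

definition cubic_graph :: "'a ugraph \<Rightarrow> bool" where
  "cubic_graph G \<longleftrightarrow> simple_graph G \<and> (\<forall>v \<in> verts G. degree G v = 3)"

text \<open>A total coloring colors the disjoint union of the vertex set (left summand) and the
  edge set (right summand). Values of the coloring outside this union are irrelevant.\<close>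

definition elements :: "'a ugraph \<Rightarrow> ('a + 'a set) set" where
  "elements G = verts G <+> edges G"

definition four_total_coloring :: "'a ugraph \<Rightarrow> ('a + 'a set \<Rightarrow> nat) \<Rightarrow> bool" where
  "four_total_coloring G c \<longleftrightarrow>
     (\<forall>x \<in> elements G. c x \<in> {1..4}) \<and>
     (\<forall>u \<in> verts G. \<forall>v \<in> verts G. {u, v} \<in> edges G \<longrightarrow> c (Inl u) \<noteq> c (Inl v)) \<and>
     (\<forall>e \<in> edges G. \<forall>f \<in> edges G. e \<noteq> f \<and> e \<inter> f \<noteq> {} \<longrightarrow> c (Inr e) \<noteq> c (Inr f)) \<and>
     (\<forall>v \<in> verts G. \<forall>e \<in> edges G. v \<in> e \<longrightarrow> c (Inl v) \<noteq> c (Inr e))"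

definition color_class :: "'a ugraph \<Rightarrow> ('a + 'a set \<Rightarrow> nat) \<Rightarrow> nat \<Rightarrow> ('a + 'a set) set" where
  "color_class G c i = {x \<in> elements G. c x = i}"

definition configuration :: "'a ugraph \<Rightarrow> ('a + 'a set \<Rightarrow> nat) \<Rightarrow> nat multiset" where
  "configuration G c = image_mset (\<lambda>i. card (color_class G c i)) (mset_set {1..4})"

definition equitable :: "'a ugraph \<Rightarrow> ('a + 'a set \<Rightarrow> nat) \<Rightarrow> bool" where
  "equitable G c \<longleftrightarrow>
     (\<forall>i \<in> {1..4}. \<forall>j \<in> {1..4}.
        \<bar>int (card (color_class G c i)) - int (card (color_class G c j))\<bar> \<le> 1)"

text \<open>This is a simple graph, the cycle of length \<open>k\<close>, only for \<open>k \<ge> 3\<close>.\<close>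

definition cycle_graph :: "nat \<Rightarrow> nat ugraph" where
  "cycle_graph k = \<lparr>verts = {0..<k}, edges = {{i, (i + 1) mod k} |i. i < k}\<rparr>"

definition complete_graph :: "nat \<Rightarrow> nat ugraph" where
  "complete_graph k = \<lparr>verts = {0..<k}, edges = {{i, j} |i j. i < k \<and> j < k \<and> i \<noteq> j}\<rparr>"

definition cartesian_product :: "'a ugraph \<Rightarrow> 'b ugraph \<Rightarrow> ('a \<times> 'b) ugraph" where
  "cartesian_product G H =
     \<lparr>verts = verts G \<times> verts H,
      edges = {{(u, x), (v, x)} |u v x. {u, v} \<in> edges G \<and> x \<in> verts H} \<union>
              {{(u, x), (u, y)} |u x y. u \<in> verts G \<and> {x, y} \<in> edges H}\<rparr>"

text \<open>The circular ladder on \<open>n\<close> vertices (not \<open>n\<close> rungs), meaningful for even \<open>n \<ge> 6\<close>.\<close>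

definition circular_ladder :: "nat \<Rightarrow> (nat \<times> nat) ugraph" where
  "circular_ladder n = cartesian_product (cycle_graph (n div 2)) (complete_graph 2)"

end

theory Submission
  imports Defs
begin

(* In a cubic graph every vertex sees each of the four colors exactly once, so the vertices of
   color i together with the endpoints of the edges of color i partition the vertex set. With
   V i vertices and E i edges of color i this gives V i + 2 E i = n, so |c_i| = (n + V i) / 2 and
   V i is even. The vertices of color i are independent, hence meet exactly 3 V i edges, none of
   which has color i. For n = 12 there are 18 edges, so 3 V i + E i \<le> 18 forces V i \<le> 4. As the V i
   are even with sum 12, they are 4, 4, 4, 0 or 4, 4, 2, 2 in some order. *)

section \<open>Color classes of a 4-total coloring\<close>

definition vertex_class :: "'a ugraph \<Rightarrow> ('a + 'a set \<Rightarrow> nat) \<Rightarrow> nat \<Rightarrow> 'a set" where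
  "vertex_class G c i = {v \<in> verts G. c (Inl v) = i}"

definition edge_class :: "'a ugraph \<Rightarrow> ('a + 'a set \<Rightarrow> nat) \<Rightarrow> nat \<Rightarrow> 'a set set" where
  "edge_class G c i = {e \<in> edges G. c (Inr e) = i}"

lemma simple_graph_finite:
  assumes "simple_graph G"
  shows "finite (verts G)" "finite (edges G)" "finite (vertex_class G c i)"
    "finite (edge_class G c i)"
proof -
  show fv: "finite (verts G)"
    using assms by (simp add: simple_graph_def)
  have "edges G \<subseteq> Pow (verts G)"
    using assms by (auto simp: simple_graph_def)
  then show fe: "finite (edges G)"
    using fv by (meson finite_Pow_iff finite_subset)
  show "finite (vertex_class G c i)" "finite (edge_class G c i)"
    using fv fe by (auto simp: vertex_class_def edge_class_def)
qed

lemma card_color_class: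
  assumes "simple_graph G"
  shows "card (color_class G c i) = card (vertex_class G c i) + card (edge_class G c i)"
proof -
  have "color_class G c i = vertex_class G c i <+> edge_class G c i"
    by (auto simp: color_class_def elements_def vertex_class_def edge_class_def)
  then show ?thesis
    using simple_graph_finite[OF assms] by (simp add: card_Plus)
qed

lemma sum_card_fibres:
  fixes f :: "'b \<Rightarrow> nat"
  assumes "finite A" "\<forall>x \<in> A. f x \<in> {1..4}"
  shows "(\<Sum>i \<in> {1..4}. card {x \<in> A. f x = i}) = card A"
proof -
  have "A = (\<Union>i \<in> {1..4}. {x \<in> A. f x = i})"
    using assms(2) by auto
  also have "card \<dots> = (\<Sum>i \<in> {1..4}. card {x \<in> A. f x = i})"
    using assms(1) by (intro card_UN_disjoint) auto
  finally show ?thesis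
    by simp
qed

text \<open>It makes the edge stars of distinct nonadjacent vertices disjoint: a shared edge would
  have to be the pair of the two vertices.\<close>

lemma simple_graph_edge_eq:
  assumes "simple_graph G" "e \<in> edges G" "u \<in> e" "v \<in> e" "u \<noteq> v"
  shows "e = {u, v}"
proof -
  have "card e = 2"
    using assms by (simp add: simple_graph_def)
  then show ?thesis
    using assms(3-5) by (auto simp: card_2_iff)
qed

locale cubic_total_coloring =
  fixes G :: "'a ugraph" and c :: "'a + 'a set \<Rightarrow> nat"
  assumes cubic: "cubic_graph G"
    and coloring: "four_total_coloring G c"
begin

lemma simple: "simple_graph G"
  using cubic by (simp add: cubic_graph_def)

lemmas finite_classes [simp] = simple_graph_finite[OF simple]

lemma edge_subset_verts: "e \<in> edges G \<Longrightarrow> e \<subseteq> verts G"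
  using simple by (simp add: simple_graph_def)

lemma adjacent_neq: "{u, v} \<in> edges G \<Longrightarrow> c (Inl u) \<noteq> c (Inl v)"
  using coloring edge_subset_verts[of "{u, v}"] by (simp add: four_total_coloring_def)

lemma incident_neq: "e \<in> edges G \<Longrightarrow> v \<in> e \<Longrightarrow> c (Inl v) \<noteq> c (Inr e)"
  using coloring edge_subset_verts[of e] by (simp add: four_total_coloring_def subset_iff)

lemma adjacent_edges_neq:
  "e \<in> edges G \<Longrightarrow> f \<in> edges G \<Longrightarrow> v \<in> e \<Longrightarrow> v \<in> f \<Longrightarrow> c (Inr e) = c (Inr f) \<Longrightarrow> e = f"
  using coloring unfolding four_total_coloring_def by blast

lemma vertex_color: "v \<in> verts G \<Longrightarrow> c (Inl v) \<in> {1..4}"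
  and edge_color: "e \<in> edges G \<Longrightarrow> c (Inr e) \<in> {1..4}"
  using coloring by (simp_all add: four_total_coloring_def elements_def InlI InrI)

lemma incident_color_neq:
  "v \<in> vertex_class G c i \<Longrightarrow> e \<in> edge_class G c i \<Longrightarrow> v \<notin> e"
  using incident_neq[of e v] by (auto simp: vertex_class_def edge_class_def)

text \<open>A vertex and its three edges are four elements with pairwise distinct colors, so
  \<open>c\<close> maps them injectively, hence onto, the set of four colors.\<close>

lemma color_at_vertex:
  assumes v: "v \<in> verts G" and i: "i \<in> {1..4}"
  shows "c (Inl v) = i \<or> (\<exists>e \<in> edges G. v \<in> e \<and> c (Inr e) = i)"
proof -
  define I where "I = {e \<in> edges G. v \<in> e}"
  define S where "S = insert (Inl v) (Inr ` I)"
  have fin: "finite I"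
    by (simp add: I_def)
  have "card I = 3"
    using cubic v by (simp add: cubic_graph_def degree_def I_def)
  then have card: "card S = 4"
    using fin by (simp add: S_def card_image image_iff)
  have inj: "inj_on c S"
  proof -
    have "inj_on (c \<circ> Inr) I"
      by (rule inj_onI) (use adjacent_edges_neq[of _ _ v] in \<open>simp add: I_def\<close>)
    moreover have "c (Inl v) \<noteq> c (Inr e)" if "e \<in> I" for e
      using that incident_neq by (simp add: I_def)
    ultimately show ?thesis
      by (auto simp: S_def comp_inj_on_iff inj_on_imageI)
  qed
  have "c ` S \<subseteq> {1..4}"
    using vertex_color edge_color v by (auto simp: S_def I_def simp del: atLeastAtMost_iff)
  moreover have "card (c ` S) = card {1..4::nat}"
    using card inj by (simp add: card_image)
  ultimately have "c ` S = {1..4}"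
    by (intro card_subset_eq) auto
  then obtain z where "z \<in> S" "c z = i"
    using i by (metis imageE)
  then show ?thesis
    by (auto simp: S_def I_def)
qed

lemma vertex_edge_count:
  assumes i: "i \<in> {1..4}"
  shows "card (vertex_class G c i) + 2 * card (edge_class G c i) = order G"
proof -
  let ?V = "vertex_class G c i" and ?E = "edge_class G c i"
  have verts_eq: "verts G = ?V \<union> \<Union>?E"
  proof
    show "verts G \<subseteq> ?V \<union> \<Union>?E"
      using color_at_vertex[OF _ i] by (auto simp: vertex_class_def edge_class_def)
    show "?V \<union> \<Union>?E \<subseteq> verts G"
      using simple by (auto simp: vertex_class_def edge_class_def simple_graph_def)
  qed
  have "?V \<inter> \<Union>?E = {}"
    using incident_color_neq by blast
  moreover have "card (\<Union>?E) = 2 * card ?E"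
  proof -
    have "pairwise disjnt ?E"
      using adjacent_edges_neq by (fastforce simp: pairwise_def disjnt_def edge_class_def)
    moreover have "card e = 2" if "e \<in> ?E" for e
      using that simple by (auto simp: edge_class_def simple_graph_def)
    ultimately show ?thesis
      \<comment> \<open>Each edge is finite because its cardinality 2 is positive.\<close>
      by (subst card_Union_disjoint) (auto intro: card_ge_0_finite)
  qed
  moreover have "finite (\<Union>?E)"
    using verts_eq finite_classes(1) by (metis finite_Un)
  ultimately show ?thesis
    unfolding order_def verts_eq by (simp add: card_Un_disjoint)
qed

text \<open>For a given order, the size of a color class depends only on its number of vertices. The
  configuration of an explicit coloring can thus be found by counting colored vertices
  alone.\<close>

lemma card_color_class_double:
  assumes "i \<in> {1..4}"
  shows "2 * card (color_class G c i) = order G + card (vertex_class G c i)"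
  using vertex_edge_count[OF assms] card_color_class[OF simple, of c i] by simp

lemma independent_edge_bound:
  "3 * card (vertex_class G c i) + card (edge_class G c i) \<le> card (edges G)"
proof -
  let ?V = "vertex_class G c i" and ?E = "edge_class G c i"
  \<comment> \<open>\<open>N\<close> is the set of edges that meet \<open>?V\<close>. Independence
    of \<open>?V\<close> makes this a disjoint union of stars of size 3.\<close>
  define N where "N = (\<Union>v \<in> ?V. {e \<in> edges G. v \<in> e})"
  have "card N = (\<Sum>v \<in> ?V. card {e \<in> edges G. v \<in> e})"
    unfolding N_def
  proof (intro card_UN_disjoint ballI impI)
    fix u v
    assume uv: "u \<in> ?V" "v \<in> ?V" "u \<noteq> v"
    then have "{u, v} \<notin> edges G"
      using adjacent_neq[of u v] by (auto simp: vertex_class_def)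
    then show "{e \<in> edges G. u \<in> e} \<inter> {e \<in> edges G. v \<in> e} = {}"
      using simple_graph_edge_eq[OF simple _ _ _ uv(3)] by auto
  qed auto
  also have "\<dots> = (\<Sum>v \<in> ?V. 3)"
    using cubic by (intro sum.cong) (auto simp: cubic_graph_def degree_def vertex_class_def)
  finally have card_N: "card N = 3 * card ?V"
    by simp
  have "N \<inter> ?E = {}"
    using incident_color_neq by (auto simp: N_def)
  moreover have "finite N"
    by (simp add: N_def)
  ultimately have "3 * card ?V + card ?E = card (N \<union> ?E)"
    using card_N by (simp add: card_Un_disjoint)
  also have "\<dots> \<le> card (edges G)"
    by (intro card_mono) (auto simp: N_def edge_class_def)
  finally show ?thesis .
qed

lemma sum_vertex_classes: "(\<Sum>i \<in> {1..4}. card (vertex_class G c i)) = order G"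
  unfolding vertex_class_def order_def
  by (intro sum_card_fibres) (use vertex_color in auto)

lemma sum_edge_classes: "(\<Sum>i \<in> {1..4}. card (edge_class G c i)) = card (edges G)"
  unfolding edge_class_def by (intro sum_card_fibres) (use edge_color in auto)

end

section \<open>Configurations at order 12\<close>

lemma sum_1_to_4: "(\<Sum>i \<in> {1..4}. f i) = f 1 + f 2 + f 3 + f (4::nat)"
  for f :: "nat \<Rightarrow> nat"
  by (simp add: numeral_eq_Suc atLeastAtMostSuc_conv add.assoc)

lemma configuration_eq:
  "configuration G c = {#card (color_class G c 1), card (color_class G c 2),
     card (color_class G c 3), card (color_class G c 4)#}"
proof -
  have "{1..4} = {1, 2, 3, 4::nat}"
    by auto
  then show ?thesis
    by (simp add: configuration_def)
qed

lemma configuration_order_12: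
  assumes "cubic_graph G" "order G = 12" "four_total_coloring G c"
  shows "configuration G c = {#8, 8, 7, 7#} \<or> configuration G c = {#8, 8, 8, 6#}"
proof -
  interpret cubic_total_coloring G c
    using assms by unfold_locales
  let ?V = "\<lambda>i. card (vertex_class G c i)" and ?E = "\<lambda>i. card (edge_class G c i)"
  have count: "?V i + 2 * ?E i = 12" if "i \<in> {1..4}" for i
    using vertex_edge_count[OF that] assms(2) by simp
  have sumV: "?V 1 + ?V 2 + ?V 3 + ?V 4 = 12"
    using sum_vertex_classes assms(2) by (simp only: sum_1_to_4)
  have sumE: "?E 1 + ?E 2 + ?E 3 + ?E 4 = card (edges G)"
    using sum_edge_classes by (simp only: sum_1_to_4)
  \<comment> \<open>Adding \<open>count\<close> over the four colors gives 12 + 2 |E| = 48.\<close>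
  have "card (edges G) = 18"
    using sumV sumE count[of 1] count[of 2] count[of 3] count[of 4] by simp
  \<comment> \<open>By \<open>count\<close>, \<open>?V i\<close> is even and the class has size 6 +
    \<open>?V i\<close> / 2. The edge bound leaves only 0, 2 and 4 for \<open>?V i\<close>.\<close>
  then have size: "card (color_class G c i) \<in> {6, 7, 8}" if "i \<in> {1..4}" for i
    using count[OF that] independent_edge_bound[of i] card_color_class[OF simple, of c i] by auto
  \<comment> \<open>There are 12 + 18 = 30 elements, 2 fewer than four classes of size 8 would hold.
    Either one class is short by 2, or two classes are short by 1.\<close>
  have "card (color_class G c 1) + card (color_class G c 2) + card (color_class G c 3)
      + card (color_class G c 4) = 30"
    using sumV sumE \<open>card (edges G) = 18\<close> by (simp add: card_color_class[OF simple])
  then show ?thesis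
    unfolding configuration_eq using size[of 1] size[of 2] size[of 3] size[of 4]
    by (auto simp: add_mset_commute)
qed

section \<open>Colorings of circular ladders\<close>

text \<open>Each cycle edge is indexed by the end from which it leads to the cyclic successor. For
  \<open>k \<ge> 3\<close> this index is unique, so colors of edges can be given as functions of
  indices.\<close>

definition rail :: "nat \<Rightarrow> nat \<Rightarrow> nat \<Rightarrow> (nat \<times> nat) set" where
  "rail k u x = {(u, x), (Suc u mod k, x)}"

definition rung :: "nat \<Rightarrow> (nat \<times> nat) set" where
  "rung u = {(u, 0), (u, 1)}"

lemma circular_ladder_verts: "verts (circular_ladder (2 * k)) = {0..<k} \<times> {0..<2}"
  by (simp add: circular_ladder_def cartesian_product_def cycle_graph_def complete_graph_def)

lemma circular_ladder_edges:
  "edges (circular_ladder (2 * k)) = {rail k u x |u x. u < k \<and> x < 2} \<union> {rung u |u. u < k}"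
proof -
  have "{{(u, x), (v, x)} |u v x. {u, v} \<in> edges (cycle_graph k) \<and> x \<in> {0..<2::nat}} =
      {rail k u x |u x. u < k \<and> x < 2}"
    by (fastforce simp: cycle_graph_def rail_def doubleton_eq_iff)
  moreover have "{{(u, x), (u, y)} |u x y. u \<in> {0..<k} \<and> {x, y} \<in> edges (complete_graph 2)} =
      {rung u |u. u < k}"
    by (fastforce simp: complete_graph_def rung_def doubleton_eq_iff less_2_cases_iff)
  ultimately show ?thesis
    by (simp add: circular_ladder_def cartesian_product_def cycle_graph_def complete_graph_def)
qed

lemma cycle_successor:
  assumes "k \<ge> 3" "w < k"
  obtains u where "u < k" "Suc u mod k = w"
proof (cases w)
  case 0
  then show ?thesis
    using assms that[of "k - 1"] by simp
next
  case (Suc u)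
  then show ?thesis
    using assms that[of u] by simp
qed

lemma Suc_mod_inj:
  assumes "u < k" "v < k" "Suc u mod k = Suc v mod k"
  shows "u = v"
  using assms by (auto simp: mod_Suc split: if_splits)

text \<open>The first inequality excludes loops. The second keeps a rail from coinciding with its
  successor read backwards, which would happen on a cycle of length 2.\<close>

lemma Suc_mod_neq:
  assumes "k \<ge> 3" "u < k"
  shows "Suc u mod k \<noteq> u" "Suc (Suc u mod k) mod k \<noteq> u"
  using assms by (auto simp: mod_Suc split: if_splits)

lemma rail_eq_iff:
  assumes "k \<ge> 3" "u < k" "v < k"
  shows "rail k u x = rail k v y \<longleftrightarrow> u = v \<and> x = y"
  using Suc_mod_neq[OF assms(1)] assms by (auto simp: rail_def doubleton_eq_iff)

lemma rung_eq_iff: "rung u = rung v \<longleftrightarrow> u = v"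
  by (auto simp: rung_def doubleton_eq_iff)

lemma rail_neq_rung:
  assumes "k \<ge> 3" "u < k"
  shows "rail k u x \<noteq> rung v"
  using Suc_mod_neq[OF assms] by (auto simp: rail_def rung_def doubleton_eq_iff)

text \<open>The vertex is written as a successor \<open>w\<close> of \<open>u\<close> because its
  incoming rail carries the index \<open>u\<close> of the predecessor, while its outgoing rail
  carries the index \<open>w\<close>. This avoids subtraction modulo \<open>k\<close>.\<close>

lemma circular_ladder_incident:
  assumes "k \<ge> 3" "u < k" "x < 2" "w = Suc u mod k"
  shows "{e \<in> edges (circular_ladder (2 * k)). (w, x) \<in> e} = {rail k u x, rail k w x, rung w}"
proof -
  have w: "w < k"
    using assms by simp
  \<comment> \<open>A rail that ends at \<open>w\<close> starts at \<open>u\<close>, since the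
    cyclic successor is injective.\<close>
  have in_rail: "(w, x) \<in> rail k v y \<longleftrightarrow> y = x \<and> (v = w \<or> v = u)" if "v < k" for v y
    using Suc_mod_inj[OF that assms(2)] assms(4) by (auto simp: rail_def)
  have in_rung: "(w, x) \<in> rung v \<longleftrightarrow> v = w" for v
    using assms(3) by (auto simp: rung_def less_2_cases_iff)
  show ?thesis
  proof (intro equalityI subsetI)
    fix e
    assume "e \<in> {e \<in> edges (circular_ladder (2 * k)). (w, x) \<in> e}"
    then consider v y where "e = rail k v y" "v < k" "(w, x) \<in> rail k v y"
      | v where "e = rung v" "(w, x) \<in> rung v"
      unfolding circular_ladder_edges by blast
    then show "e \<in> {rail k u x, rail k w x, rung w}"
      by cases (auto simp: in_rail in_rung)
  next
    fix e
    assume "e \<in> {rail k u x, rail k w x, rung w}"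
    moreover have "(w, x) \<in> rail k u x" "(w, x) \<in> rail k w x" "(w, x) \<in> rung w"
      using in_rail in_rung w assms(2) by simp_all
    ultimately show "e \<in> {e \<in> edges (circular_ladder (2 * k)). (w, x) \<in> e}"
      using w assms(2,3) unfolding circular_ladder_edges by blast
  qed
qed

lemma circular_ladder_cubic:
  assumes "k \<ge> 3"
  shows "cubic_graph (circular_ladder (2 * k))"
  unfolding cubic_graph_def
proof
  show "simple_graph (circular_ladder (2 * k))"
    using Suc_mod_neq(1)[OF assms] assms
    by (force simp: simple_graph_def circular_ladder_edges circular_ladder_verts rail_def rung_def
        card_insert_if)
  show "\<forall>v \<in> verts (circular_ladder (2 * k)). degree (circular_ladder (2 * k)) v = 3"
  proof
    fix v
    assume "v \<in> verts (circular_ladder (2 * k))"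
    then obtain w x where v: "v = (w, x)" "w < k" "x < 2"
      by (auto simp: circular_ladder_verts)
    obtain u where u: "u < k" "Suc u mod k = w"
      using cycle_successor[OF assms v(2)] .
    have "distinct [rail k u x, rail k w x, rung w]"
      using assms u v Suc_mod_neq(1)[OF assms u(1)] by (auto simp: rail_eq_iff rail_neq_rung)
    then have "card {rail k u x, rail k w x, rung w} = 3"
      by simp
    then show "degree (circular_ladder (2 * k)) v = 3"
      unfolding degree_def v(1) using circular_ladder_incident[OF assms u(1) v(3) u(2)[symmetric]]
      by simp
  qed
qed

text \<open>This reduces a total coloring to a pointwise check of three tables: \<open>f\<close> for
  vertices, \<open>g\<close> for rails, \<open>r\<close> for rungs. Every conflict that involves an
  edge occurs at a single vertex, where \<open>local\<close> compares the vertex, its incoming and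
  outgoing rails and its rung. Conflicts between adjacent vertices are left to \<open>rails\<close>
  and \<open>rungs\<close>.\<close>

lemma circular_ladder_coloring:
  fixes f g :: "nat \<Rightarrow> nat \<Rightarrow> nat" and r :: "nat \<Rightarrow> nat"
  assumes k: "k \<ge> 3"
    and range: "\<And>u x. u < k \<Longrightarrow> x < 2 \<Longrightarrow> {f u x, g u x, r u} \<subseteq> {1..4}"
    and local: "\<And>u x. u < k \<Longrightarrow> x < 2 \<Longrightarrow>
      distinct [f (Suc u mod k) x, g u x, g (Suc u mod k) x, r (Suc u mod k)]"
    and rails: "\<And>u x. u < k \<Longrightarrow> x < 2 \<Longrightarrow> f u x \<noteq> f (Suc u mod k) x"
    and rungs: "\<And>u. u < k \<Longrightarrow> f u 0 \<noteq> f u 1"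
  shows "\<exists>c. four_total_coloring (circular_ladder (2 * k)) c \<and> (\<forall>u x. c (Inl (u, x)) = f u x)"
proof -
  let ?G = "circular_ladder (2 * k)"
  \<comment> \<open>An edge is only a set of two vertices, so its color is recovered from its
    representation as a rail or a rung. On edges this is well defined because the representation is
    unique.\<close>
  define h where "h e = (THE i. (\<exists>u x. u < k \<and> x < 2 \<and> e = rail k u x \<and> i = g u x) \<or>
    (\<exists>u < k. e = rung u \<and> i = r u))" for e
  have h_rail: "h (rail k u x) = g u x" if "u < k" "x < 2" for u x
    unfolding h_def using that k by (intro the_equality) (auto simp: rail_eq_iff rail_neq_rung)
  have h_rung: "h (rung u) = r u" if "u < k" for u
    unfolding h_def using that k
    by (intro the_equality) (auto simp: rung_eq_iff rail_neq_rung[symmetric])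
  define c where "c = case_sum (\<lambda>(u, x). f u x) h"
  have c_simps [simp]: "c (Inl (u, x)) = f u x" "c (Inr e) = h e" for u x e
    by (simp_all add: c_def)
  \<comment> \<open>Both remaining edge conditions follow from this: adjacent edges lie in the star
    of a common vertex, and an edge incident with \<open>v\<close> lies in the star of
    \<open>v\<close>.\<close>
  have star: "inj_on h {e \<in> edges ?G. v \<in> e} \<and> (\<forall>e \<in> edges ?G. v \<in> e \<longrightarrow> c (Inl v) \<noteq> h e)"
    if "v \<in> verts ?G" for v
  proof -
    obtain w x where v: "v = (w, x)" "w < k" "x < 2"
      using \<open>v \<in> verts ?G\<close> by (auto simp: circular_ladder_verts)
    obtain u where u: "u < k" "Suc u mod k = w"
      using cycle_successor[OF k v(2)] .
    have inc: "{e \<in> edges ?G. v \<in> e} = {rail k u x, rail k w x, rung w}"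
      using circular_ladder_incident[OF k u(1) v(3) u(2)[symmetric]] v(1) by simp
    have "distinct [f w x, g u x, g w x, r w]"
      using local[OF u(1) v(3)] u(2) by simp
    then have "inj_on h {rail k u x, rail k w x, rung w}"
      "\<forall>e \<in> {rail k u x, rail k w x, rung w}. c (Inl v) \<noteq> h e"
      using u v by (auto simp: h_rail h_rung)
    then show ?thesis
      unfolding inc[symmetric] by blast
  qed
  have "four_total_coloring ?G c"
    unfolding four_total_coloring_def
  proof (intro conjI ballI impI)
    fix z
    assume "z \<in> elements ?G"
    then show "c z \<in> {1..4}"
      using range by (fastforce simp: elements_def circular_ladder_verts circular_ladder_edges
          h_rail h_rung)
  next
    fix p q
    assume "{p, q} \<in> edges ?G"
    then show "c (Inl p) \<noteq> c (Inl q)"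
      using rails rungs
      by (auto simp: circular_ladder_edges rail_def rung_def doubleton_eq_iff) metis+
  next
    fix e e'
    assume e: "e \<in> edges ?G" "e' \<in> edges ?G" "e \<noteq> e' \<and> e \<inter> e' \<noteq> {}"
    then obtain v where v: "v \<in> e" "v \<in> e'"
      by blast
    then have "v \<in> verts ?G"
      using e(1) circular_ladder_cubic[OF k] unfolding cubic_graph_def simple_graph_def by blast
    then have "inj_on h {e \<in> edges ?G. v \<in> e}"
      using star by blast
    then have "h e \<noteq> h e'"
      by (rule inj_on_contraD) (use e v in auto)
    then show "c (Inr e) \<noteq> c (Inr e')"
      by simp
  next
    fix v e
    assume "v \<in> verts ?G" "e \<in> edges ?G" "v \<in> e"
    then show "c (Inl v) \<noteq> c (Inr e)"
      using star by auto
  qed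
  then show ?thesis
    by (intro exI[of _ c]) simp
qed

section \<open>The circular ladder on 12 vertices and its two colorings\<close>

lemma L12_cubic: "cubic_graph (circular_ladder 12)"
  using circular_ladder_cubic[of 6] by simp

lemma less_6_cases_iff: "u < 6 \<longleftrightarrow> u \<in> {0, 1, 2, 3, 4, 5}" for u :: nat
  by (simp add: numeral_eq_Suc less_Suc_eq disj_ac)

lemma L12_verts: "verts (circular_ladder 12) = {0, 1, 2, 3, 4, 5} \<times> {0, 1}"
proof -
  have "{0..<6} = {0, 1, 2, 3, 4, 5::nat}"
    unfolding set_eq_iff less_6_cases_iff[symmetric] by simp
  moreover have "{0..<2} = {0, 1::nat}"
    unfolding set_eq_iff by (simp add: less_2_cases_iff)
  ultimately show ?thesis
    using circular_ladder_verts[of 6] by simp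
qed

text \<open>The cardinality becomes the length of a filtered explicit list, which the simplifier can
  evaluate once the vertex colors are known.\<close>

lemma L12_card_vertex_class:
  "card (vertex_class (circular_ladder 12) c i) =
     length (filter (\<lambda>v. c (Inl v) = i) (List.product [0, 1, 2, 3, 4, 5] [0, 1]))"
proof -
  have "vertex_class (circular_ladder 12) c i =
      set (filter (\<lambda>v. c (Inl v) = i) (List.product [0, 1, 2, 3, 4, 5] [0, 1]))"
    by (simp only: vertex_class_def L12_verts set_filter set_product list.set)
  then show ?thesis
    by (simp only:) (intro distinct_card distinct_filter distinct_product; simp)
qed

lemma L12_configuration:
  assumes c: "four_total_coloring (circular_ladder 12) c"
    and "\<And>i. i \<in> {1..4} \<Longrightarrow> card (vertex_class (circular_ladder 12) c i) = 2 * n i"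
  shows "configuration (circular_ladder 12) c = {#6 + n 1, 6 + n 2, 6 + n 3, 6 + n 4#}"
proof -
  interpret cubic_total_coloring "circular_ladder 12" c
    using L12_cubic c by unfold_locales
  have "order (circular_ladder 12) = 12"
    by (simp add: order_def L12_verts)
  then have "card (color_class (circular_ladder 12) c i) = 6 + n i" if "i \<in> {1..4}" for i
    using card_color_class_double[OF that] assms(2)[OF that] by simp
  then show ?thesis
    by (simp add: configuration_eq)
qed

lemma L12_coloring_8886:
  "\<exists>c. four_total_coloring (circular_ladder 12) c
     \<and> configuration (circular_ladder 12) c = {#8, 8, 8, 6#}"
proof -
  \<comment> \<open>The colors 1, 2, 3 repeat along both cycles, which closes up because 3 divides
    6. The shift by \<open>x\<close> separates the ends of each rung.\<close>
  define f :: "nat \<Rightarrow> nat \<Rightarrow> nat" where "f u x = Suc ((u + x) mod 3)" for u x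
  have "\<exists>c. four_total_coloring (circular_ladder (2 * 6)) c \<and> (\<forall>u x. c (Inl (u, x)) = f u x)"
    \<comment> \<open>A rail takes the one color among 1, 2, 3 that is missing at its ends, namely
      that of the vertex one step beyond it. Color 4 occurs on the rungs only.\<close>
    by (rule circular_ladder_coloring[where g = "\<lambda>u x. f (u + 2) x" and r = "\<lambda>_. 4"])
      (auto simp: f_def less_6_cases_iff less_2_cases_iff)
  then obtain c where c: "four_total_coloring (circular_ladder 12) c"
    and cf: "\<And>u x. c (Inl (u, x)) = f u x"
    by auto
  \<comment> \<open>Colors 1, 2, 3 each occur on four vertices, and color 4 on none.\<close>
  define n :: "nat \<Rightarrow> nat" where "n i = (if i = 4 then 0 else 2)" for i
  have "card (vertex_class (circular_ladder 12) c i) = 2 * n i" if "i \<in> {1..4}" for i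
  proof -
    have "i \<in> {1, 2, 3, 4}"
      using that by auto
    then show ?thesis
      by (auto simp: L12_card_vertex_class cf f_def n_def)
  qed
  from L12_configuration[OF c this] show ?thesis
    using c by (auto simp: n_def)
qed

text \<open>The first three positions carry a cyclic pattern of 1, 2, 3 on vertices and rails with
  rungs of color 4. The last three repeat it with colors 2 and 4 interchanged, so the vertices that
  would have color 2 are shared equally between 2 and 4.\<close>

lemma L12_coloring_8877:
  "\<exists>c. four_total_coloring (circular_ladder 12) c
     \<and> configuration (circular_ladder 12) c = {#8, 8, 7, 7#}"
proof -
  (* The three tables were found by computer search. *)
  define f :: "nat \<Rightarrow> nat \<Rightarrow> nat" where
    "f u x = [[1, 2], [3, 1], [2, 3], [1, 4], [3, 1], [4, 3]] ! u ! x" for u x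
  define g :: "nat \<Rightarrow> nat \<Rightarrow> nat" where
    "g u x = [[2, 3], [1, 2], [3, 1], [4, 3], [1, 4], [3, 1]] ! u ! x" for u x
  define r :: "nat \<Rightarrow> nat" where
    "r u = [4, 4, 4, 2, 2, 2] ! u" for u
  have "\<exists>c. four_total_coloring (circular_ladder (2 * 6)) c \<and> (\<forall>u x. c (Inl (u, x)) = f u x)"
    by (rule circular_ladder_coloring[where g = g and r = r])
      (auto simp: f_def g_def r_def less_6_cases_iff less_2_cases_iff)
  then obtain c where c: "four_total_coloring (circular_ladder 12) c"
    and cf: "\<And>u x. c (Inl (u, x)) = f u x"
    by auto
  \<comment> \<open>Colors 1 and 3 occur on four vertices each, colors 2 and 4 on two each.\<close>
  define n :: "nat \<Rightarrow> nat" where "n i = (if odd i then 2 else 1)" for i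
  have "card (vertex_class (circular_ladder 12) c i) = 2 * n i" if "i \<in> {1..4}" for i
  proof -
    have "i \<in> {1, 2, 3, 4}"
      using that by auto
    then show ?thesis
      by (auto simp: L12_card_vertex_class cf f_def n_def)
  qed
  from L12_configuration[OF c this] show ?thesis
    using c by (auto simp: n_def add_mset_commute)
qed

section \<open>Equitability of the two configurations\<close>

lemma configuration_8886_not_equitable:
  assumes "configuration G c = {#8, 8, 8, 6#}"
  shows "\<not> equitable G c"
proof
  assume "equitable G c"
  \<comment> \<open>The multiset does not record which color has which size; membership still yields
    some color of size 8 and some color of size 6.\<close>
  have size: "\<exists>i \<in> {1..4}. card (color_class G c i) = m"
    if "m \<in># {#8, 8, 8, 6#}" for m
    using that unfolding assms[symmetric] by (auto simp: configuration_def)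
  obtain i j where "i \<in> {1..4}" "card (color_class G c i) = 8"
    "j \<in> {1..4}" "card (color_class G c j) = 6"
    using size[of 8] size[of 6] by auto
  then show False
    using \<open>equitable G c\<close> by (force simp: equitable_def)
qed

text \<open>For a non-equitable coloring this rules out the first alternative of
  \<open>configuration_order_12\<close> and so gives uniqueness.\<close>

lemma configuration_8877_equitable:
  assumes "configuration G c = {#8, 8, 7, 7#}"
  shows "equitable G c"
proof -
  have size: "card (color_class G c i) \<in> {7, 8}" if "i \<in> {1..4}" for i
  proof -
    have "card (color_class G c i) \<in># configuration G c"
      using that by (simp add: configuration_def)
    then show ?thesis
      by (auto simp: assms)
  qed
  show ?thesis
    unfolding equitable_def
  proof (intro ballI)
    fix i j :: nat
    assume "i \<in> {1..4}" "j \<in> {1..4}"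
    from size[OF this(1)] size[OF this(2)]
    show "\<bar>int (card (color_class G c i)) - int (card (color_class G c j))\<bar> \<le> 1"
      by auto
  qed
qed

theorem theorem5p2:
  shows "(\<forall>(G :: 'a ugraph) c.
            cubic_graph G \<and> order G = 12 \<and> four_total_coloring G c \<longrightarrow>
              configuration G c = {#8, 8, 7, 7#} \<or> configuration G c = {#8, 8, 8, 6#})
       \<and> (\<exists>c. four_total_coloring (circular_ladder 12) c
              \<and> configuration (circular_ladder 12) c = {#8, 8, 7, 7#})
       \<and> (\<exists>c. four_total_coloring (circular_ladder 12) c
              \<and> configuration (circular_ladder 12) c = {#8, 8, 8, 6#})
       \<and> (\<forall>(G :: 'a ugraph) c.
            cubic_graph G \<and> order G = 12 \<and> four_total_coloring G c \<and> \<not> equitable G c \<longrightarrow>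
              configuration G c = {#8, 8, 8, 6#})
       \<and> (\<exists>(G :: (nat \<times> nat) ugraph) c.
            cubic_graph G \<and> order G = 12 \<and> four_total_coloring G c \<and> \<not> equitable G c
              \<and> configuration G c = {#8, 8, 8, 6#})"
proof (intro conjI)
  show "\<exists>(G :: (nat \<times> nat) ugraph) c.
      cubic_graph G \<and> order G = 12 \<and> four_total_coloring G c \<and> \<not> equitable G c
        \<and> configuration G c = {#8, 8, 8, 6#}"
  proof -
    have "order (circular_ladder 12) = 12"
      by (simp add: order_def L12_verts)
    then show ?thesis
      using L12_cubic L12_coloring_8886 configuration_8886_not_equitable by blast
  qed
qed (use configuration_order_12 configuration_8877_equitable L12_coloring_8877
  L12_coloring_8886 in blast)+

end
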